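(* Let $(U_1,R_1)$ and $(U_2,R_2)$ be approximation spaces with binary operations $\ast_1$ on $U_1$ and $\ast_2$ on $U_2$, and let $G_1\subset U_1$, $G_2\subset U_2$ be topological rough groups (with topologies $\tau_i$ on $\overline{G_i}$, and induced topologies on $G_i$, $i=1,2$) with rough identity elements $e_1,e_2$. Assume $G_1$ and $G_2$ are locally compact Hausdorff spaces, and let $f:\overline{G_1}\to\overline{G_2}$ be a continuous rough homomorphism of $G_1$ onto $G_2$. Suppose that: (1) $e_1\in G_1$ and $e_2\in G_2$; (2) $G_1$ is open in $\overline{G_1}$ and $G_2$ is open in $\overline{G_2}$; (3) $G_1$ is $\sigma$-compact. Then $f$ is open as a mapping from $G_1$ onto $G_2$, i.e. $f(O)$ is open in $G_2$ for every open subset $O$ of $G_1$.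
   Context: An approximation space $(U,R)$ is a non-empty set $U$ with an equivalence relation $R$; for $X\subset U$ the upper approximation is $\overline{X}=\{x\in U:[x]_R\cap X\neq\emptyset\}$, where $[x]_R$ is the equivalence class of $x$. Let $U$ carry a binary operation, written $xy$ (or $x\ast y$). A subset $G\subset U$ is a rough group if: (1) $xy\in\overline{G}$ for all $x,y\in G$; (2) $(xy)z=x(yz)$ for all $x,y,z\in\overline{G}$; (3) there is $e\in\overline{G}$ (the rough identity element) with $ex=xe=x$ for all $x\in\overline{G}$; (4) for every $x\in G$ there is $y\in G$ with $xy=yx=e$ (written $y=x^{-1}$). A topological rough group is a rough group $G$ together with a topology $\tau$ on $\overline{G}$ such that, with $\tau_G$ the subspace topology on $G$, the multiplication $G\times G\to\overline{G}$, $(x,y)\mapsto xy$, is continuous (product topology of $\tau_G$ on $G\times G$, $\tau$ on $\overline{G}$) and the inverse mapping $G\to G$, $x\mapsto x^{-1}$, is continuous for $\tau_G$. Topological properties of $G$ refer to $(G,\tau_G)$. A rough homomorphism between rough groups $G_1\subset U_1$ and $G_2\subset U_2$ is a surjection $\varphi:\overline{G_1}\to\overline{G_2}$ such that: (1) $\varphi|_{G_1}$ is a surjection from $G_1$ onto $G_2$; (2) $\varphi(x\ast_1 y)=\varphi(x)\ast_2\varphi(y)$ for all $x,y\in G_1\cup\{e_1\}$; (3) $\overline{H}=\varphi^{-1}(\overline{\varphi(H)})$ for every subset $H\subset G_1$ (upper approximations in $(U_1,R_1)$ and $(U_2,R_2)$ respectively). A space $X$ is locally compact if each point has an open neighborhood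 with compact closure, and $\sigma$-compact if it is a union of countably many compact subsets. *)

theory Defs
  imports "HOL-Analysis.Analysis"
begin

definition approximation_space :: "'a set \<Rightarrow> ('a \<times> 'a) set \<Rightarrow> bool"
  where "approximation_space U R \<longleftrightarrow> U \<noteq> {} \<and> equiv U R"

definition binary_operation :: "'a set \<Rightarrow> ('a \<Rightarrow> 'a \<Rightarrow> 'a) \<Rightarrow> bool"
  where "binary_operation U mul \<longleftrightarrow> (\<forall>x\<in>U. \<forall>y\<in>U. mul x y \<in> U)"

definition upper_approximation :: "'a set \<Rightarrow> ('a \<times> 'a) set \<Rightarrow> 'a set \<Rightarrow> 'a set"
  where "upper_approximation U R X = {x \<in> U. R `` {x} \<inter> X \<noteq> {}}"

definition is_rough_identity ::
    "'a set \<Rightarrow> ('a \<times> 'a) set \<Rightarrow> ('a \<Rightarrow> 'a \<Rightarrow> 'a) \<Rightarrow> 'a set \<Rightarrow> 'a \<Rightarrow> bool"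
  where "is_rough_identity U R mul G e \<longleftrightarrow>
    e \<in> upper_approximation U R G \<and>
    (\<forall>x \<in> upper_approximation U R G. mul e x = x \<and> mul x e = x)"

definition rough_group ::
    "'a set \<Rightarrow> ('a \<times> 'a) set \<Rightarrow> ('a \<Rightarrow> 'a \<Rightarrow> 'a) \<Rightarrow> 'a set \<Rightarrow> bool"
  where "rough_group U R mul G \<longleftrightarrow>
    approximation_space U R \<and> binary_operation U mul \<and> G \<subseteq> U \<and>
    (\<forall>x\<in>G. \<forall>y\<in>G. mul x y \<in> upper_approximation U R G) \<and>
    (\<forall>x \<in> upper_approximation U R G. \<forall>y \<in> upper_approximation U R G.
      \<forall>z \<in> upper_approximation U R G. mul (mul x y) z = mul x (mul y z)) \<and>
    (\<exists>e. is_rough_identity U R mul G e \<and>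
      (\<forall>x\<in>G. \<exists>y\<in>G. mul x y = e \<and> mul y x = e))"

text \<open>In a rough group the identity and the inverses are unique (lemmas
  \<open>rough_identity_eq\<close> and \<open>rough_inverse_eq\<close> below), so the
  following descriptions are well defined.\<close>

definition rough_identity ::
    "'a set \<Rightarrow> ('a \<times> 'a) set \<Rightarrow> ('a \<Rightarrow> 'a \<Rightarrow> 'a) \<Rightarrow> 'a set \<Rightarrow> 'a"
  where "rough_identity U R mul G = (THE e. is_rough_identity U R mul G e)"

definition rough_inverse ::
    "'a set \<Rightarrow> ('a \<times> 'a) set \<Rightarrow> ('a \<Rightarrow> 'a \<Rightarrow> 'a) \<Rightarrow> 'a set \<Rightarrow> 'a \<Rightarrow> 'a"
  where "rough_inverse U R mul G x =
    (THE y. y \<in> G \<and> mul x y = rough_identity U R mul G \<and> mul y x = rough_identity U R mul G)"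

lemma rough_identity_eq:
  assumes "is_rough_identity U R mul G e"
  shows "rough_identity U R mul G = e"
  unfolding rough_identity_def
proof (rule the_equality)
  show "is_rough_identity U R mul G e"
    by (rule assms)
next
  fix d assume "is_rough_identity U R mul G d"
  with assms show "d = e"
    unfolding is_rough_identity_def by metis
qed

lemma subset_upper_approximation:
  assumes "approximation_space U R" "G \<subseteq> U"
  shows "G \<subseteq> upper_approximation U R G"
  using assms
  by (auto simp: approximation_space_def upper_approximation_def equiv_def refl_on_def)

lemma rough_inverse_eq:
  assumes rg: "rough_group U R mul G" and x: "x \<in> G" and y: "y \<in> G"
    and xy: "mul x y = rough_identity U R mul G" "mul y x = rough_identity U R mul G"
  shows "rough_inverse U R mul G x = y"
  unfolding rough_inverse_def
proof (rule the_equality)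
  show "y \<in> G \<and> mul x y = rough_identity U R mul G \<and> mul y x = rough_identity U R mul G"
    using y xy by simp
next
  fix z
  assume z: "z \<in> G \<and> mul x z = rough_identity U R mul G \<and> mul z x = rough_identity U R mul G"
  let ?A = "upper_approximation U R G"
  have sub: "G \<subseteq> ?A"
    using rg subset_upper_approximation unfolding rough_group_def by blast
  obtain e where e: "is_rough_identity U R mul G e"
    using rg unfolding rough_group_def by blast
  have "mul (mul z x) y = mul z (mul x y)"
    using rg sub x y z unfolding rough_group_def by blast
  then show "z = y"
    using e rough_identity_eq[OF e] xy z sub x y unfolding is_rough_identity_def
    by (metis subsetD)
qed

text \<open>\<open>T\<close> is a topology on the upper approximation of \<open>G\<close>;
  \<open>G\<close> itself carries \<open>subtopology T G\<close>.\<close>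

definition topological_rough_group ::
    "'a set \<Rightarrow> ('a \<times> 'a) set \<Rightarrow> ('a \<Rightarrow> 'a \<Rightarrow> 'a) \<Rightarrow> 'a set \<Rightarrow> 'a topology \<Rightarrow> bool"
  where "topological_rough_group U R mul G T \<longleftrightarrow>
    rough_group U R mul G \<and>
    topspace T = upper_approximation U R G \<and>
    continuous_map (prod_topology (subtopology T G) (subtopology T G)) T (\<lambda>(x, y). mul x y) \<and>
    continuous_map (subtopology T G) (subtopology T G) (rough_inverse U R mul G)"

definition rough_homomorphism ::
    "'a set \<Rightarrow> ('a \<times> 'a) set \<Rightarrow> ('a \<Rightarrow> 'a \<Rightarrow> 'a) \<Rightarrow> 'a set \<Rightarrow>
     'b set \<Rightarrow> ('b \<times> 'b) set \<Rightarrow> ('b \<Rightarrow> 'b \<Rightarrow> 'b) \<Rightarrow> 'b set \<Rightarrow> ('a \<Rightarrow> 'b) \<Rightarrow> bool"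
  where "rough_homomorphism U1 R1 mul1 G1 U2 R2 mul2 G2 f \<longleftrightarrow>
    f ` upper_approximation U1 R1 G1 = upper_approximation U2 R2 G2 \<and>
    f ` G1 = G2 \<and>
    (\<forall>x \<in> G1 \<union> {rough_identity U1 R1 mul1 G1}. \<forall>y \<in> G1 \<union> {rough_identity U1 R1 mul1 G1}.
      f (mul1 x y) = mul2 (f x) (f y)) \<and>
    (\<forall>H. H \<subseteq> G1 \<longrightarrow> upper_approximation U1 R1 H =
      {x \<in> upper_approximation U1 R1 G1. f x \<in> upper_approximation U2 R2 (f ` H)})"

definition sigma_compact_space :: "'a topology \<Rightarrow> bool"
  where "sigma_compact_space X \<longleftrightarrow>
    (\<exists>\<K>. countable \<K> \<and> (\<forall>K\<in>\<K>. compactin X K) \<and> \<Union>\<K> = topspace X)"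

text \<open>Local compactness is the library's \<open>locally_compact_space\<close>. For
  Hausdorff spaces, the only ones considered, it says that every point has an open
  neighbourhood with compact closure: \<open>locally_compact_space_compact_closure_of\<close>.\<close>

end

theory Submission
  imports Defs
begin

text \<open>The usual open mapping argument works once every translation is restricted to the points
  that it keeps inside \<open>G\<close>; as \<open>G\<close> is open, such partial translations have open domains.
  Let \<open>O\<close> be an open neighbourhood of \<open>x\<close> in \<open>G\<^sub>1\<close>. Each \<open>y\<close> in \<open>G\<^sub>1\<close> has an open neighbourhood
  \<open>P\<close> with \<open>x (v\<inverse> w) \<in> O\<close> for all \<open>v, w \<in> P\<close>. By \<open>\<sigma>\<close>-compactness and the Baire category theorem,
  some \<open>f(P)\<close> contains a non-empty open set \<open>M\<close>. If \<open>f(c) \<in> M\<close> with \<open>c \<in> P\<close>, then the translate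
  \<open>f(x) (f(c)\<inverse> M)\<close>, cut down to \<open>G\<^sub>2\<close>, is an open neighbourhood of \<open>f(x)\<close> inside \<open>f(O)\<close>.\<close>

lemma Lindelof_space_sigma_compact:
  assumes "sigma_compact_space X"
  shows "Lindelof_space X"
proof -
  from assms obtain \<K> where K: "countable \<K>" "\<And>K. K \<in> \<K> \<Longrightarrow> compactin X K"
      and top: "\<Union>\<K> = topspace X"
    unfolding sigma_compact_space_def by auto
  have "Lindelof_space (subtopology X (\<Union>\<K>))"
    by (rule Lindelof_space_Union[OF K(1)])
      (rule compact_imp_Lindelof_space[OF compact_space_subtopology[OF K(2)]])
  then show ?thesis
    unfolding top by simp
qed

text \<open>Countably many images of sets inside the \<open>P y\<close> cover \<open>Y\<close>; were
  all their interiors empty, the Baire category theorem would give the whole of the non-empty space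
  \<open>Y\<close> empty interior.\<close>

lemma Lindelof_image_nonempty_interior:
  assumes X: "Lindelof_space X" "locally_compact_space X" "Hausdorff_space X"
    and Y: "locally_compact_space Y" "Hausdorff_space Y" "topspace Y \<noteq> {}"
    and f: "continuous_map X Y f" "f ` topspace X = topspace Y"
    and P: "\<And>y. y \<in> topspace X \<Longrightarrow> openin X (P y) \<and> y \<in> P y"
  shows "\<exists>y\<in>topspace X. Y interior_of (f ` P y) \<noteq> {}"
proof (rule ccontr)
  assume none: "\<not> ?thesis"
  have base: "neighbourhood_base_of (compactin X) X"
    using X locally_compact_space_neighbourhood_base by blast
  have "\<exists>V D. openin X V \<and> compactin X D \<and> y \<in> V \<and> V \<subseteq> D \<and> D \<subseteq> P y"
    if "y \<in> topspace X" for y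
    using base P[OF that] unfolding neighbourhood_base_of by blast
  then obtain V D where VD: "\<And>y. y \<in> topspace X \<Longrightarrow>
      openin X (V y) \<and> compactin X (D y) \<and> y \<in> V y \<and> V y \<subseteq> D y \<and> D y \<subseteq> P y"
    by metis
  have "\<exists>\<V>. countable \<V> \<and> \<V> \<subseteq> V ` topspace X \<and> \<Union>\<V> = topspace X"
  proof (rule Lindelof_spaceD[OF X(1)])
    show "\<Union>(V ` topspace X) = topspace X"
      using VD openin_subset by fast
  qed (use VD in auto)
  then obtain C where C: "countable C" "C \<subseteq> topspace X" "\<Union>(V ` C) = topspace X"
    by (smt (verit) countable_subset_image)
  have "Y interior_of \<Union>((\<lambda>y. f ` D y) ` C) = {}"
  proof (rule Baire_category_alt)
    show "completely_metrizable_space Y \<or> locally_compact_space Y \<and> regular_space Y"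
      using Y locally_compact_Hausdorff_imp_regular_space by blast
    fix T assume "T \<in> (\<lambda>y. f ` D y) ` C"
    then obtain y where y: "y \<in> topspace X" "T = f ` D y"
      using C by blast
    have "closedin Y T"
      unfolding y(2) using VD[OF y(1)] f(1) Y(2) compactin_imp_closedin image_compactin by metis
    moreover have "Y interior_of T \<subseteq> Y interior_of (f ` P y)"
      using y VD by (simp add: interior_of_mono image_mono)
    ultimately show "closedin Y T \<and> Y interior_of T = {}"
      using none y by blast
  qed (use C in auto)
  moreover have "\<Union>((\<lambda>y. f ` D y) ` C) = topspace Y"
  proof
    show "\<Union>((\<lambda>y. f ` D y) ` C) \<subseteq> topspace Y"
    proof (rule UN_least)
      fix y assume "y \<in> C"
      then have "D y \<subseteq> topspace X"
        using C(2) VD compactin_subset_topspace by (metis subsetD)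
      then show "f ` D y \<subseteq> topspace Y"
        using f(2) by blast
    qed
    have "topspace X \<subseteq> (\<Union>y\<in>C. D y)"
    proof -
      have "V y \<subseteq> D y" if "y \<in> C" for y
        using that C(2) VD by blast
      then show ?thesis
        unfolding C(3)[symmetric] by (rule UN_mono[OF subset_refl])
    qed
    then show "topspace Y \<subseteq> \<Union>((\<lambda>y. f ` D y) ` C)"
      unfolding f(2)[symmetric] by blast
  qed
  ultimately show False
    using Y by simp
qed

locale open_topological_rough_group =
  fixes U :: "'a set" and R mul G T
  assumes trg: "topological_rough_group U R mul G T"
    and openG: "openin T G"
    and identity_mem: "rough_identity U R mul G \<in> G"
begin

abbreviation e where "e \<equiv> rough_identity U R mul G"
abbreviation inv where "inv \<equiv> rough_inverse U R mul G"
abbreviation TG where "TG \<equiv> subtopology T G"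

lemma rg: "rough_group U R mul G"
  using trg unfolding topological_rough_group_def by blast

lemma subset_upper: "G \<subseteq> upper_approximation U R G"
  using rg subset_upper_approximation unfolding rough_group_def by blast

lemma topspace_TG: "topspace TG = G"
  using openG openin_subset by fastforce

lemma openin_TG: "openin TG S \<longleftrightarrow> openin T S \<and> S \<subseteq> G"
  using openG by (rule openin_open_subtopology)

text \<open>Only the three factors must lie in \<open>G\<close>; their products may leave
  it.\<close>

lemma assoc: "\<lbrakk>x \<in> G; y \<in> G; z \<in> G\<rbrakk> \<Longrightarrow> mul (mul x y) z = mul x (mul y z)"
  using rg subset_upper unfolding rough_group_def by blast

lemma is_identity: "is_rough_identity U R mul G e"
  using rg rough_identity_eq unfolding rough_group_def by metis

lemma identity: "x \<in> G \<Longrightarrow> mul e x = x" "x \<in> G \<Longrightarrow> mul x e = x"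
  using is_identity subset_upper unfolding is_rough_identity_def by blast+

lemma inverse:
  assumes "x \<in> G"
  shows "inv x \<in> G" "mul x (inv x) = e" "mul (inv x) x = e"
proof -
  obtain y where "y \<in> G" "mul x y = e" "mul y x = e"
    using rg assms rough_identity_eq unfolding rough_group_def by metis
  then show "inv x \<in> G" "mul x (inv x) = e" "mul (inv x) x = e"
    using rough_inverse_eq[OF rg assms] by metis+
qed

lemma continuous_mul: "continuous_map (prod_topology TG TG) T (\<lambda>(x, y). mul x y)"
  using trg unfolding topological_rough_group_def by blast

lemma continuous_inv: "continuous_map TG TG inv"
  using trg unfolding topological_rough_group_def by blast

text \<open>Translation by \<open>a\<close> is continuous from \<open>G\<close> into the upper
  approximation. Since \<open>G\<close> is open there, \<open>S\<close> is open in \<open>T\<close>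
  as well and can be pulled back.\<close>

lemma openin_translation_preimage:
  assumes "a \<in> G" "openin TG S"
  shows "openin TG {z \<in> G. mul a z \<in> S}"
proof -
  have "continuous_map TG (prod_topology TG TG) (\<lambda>z. (a, z))"
    using assms topspace_TG by (auto intro!: continuous_map_pairedI)
  from continuous_map_compose[OF this continuous_mul]
  have "continuous_map TG T (\<lambda>z. mul a z)"
    by (simp add: o_def)
  from openin_continuous_map_preimage[OF this, of S]
  have "openin TG {z \<in> topspace TG. mul a z \<in> S}"
    using assms openin_TG by blast
  then show ?thesis
    by (simp only: topspace_TG)
qed

text \<open>The map sending (v, w) to \<open>mul (inv v) w\<close> is continuous and takes the value
  \<open>e\<close> at (y, y).\<close>

lemma quotient_neighbourhood:
  assumes x: "x \<in> S" and S: "openin TG S" and y: "y \<in> G"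
  shows "\<exists>P. openin TG P \<and> y \<in> P \<and>
    (\<forall>v\<in>P. \<forall>w\<in>P. mul (inv v) w \<in> G \<and> mul x (mul (inv v) w) \<in> S)"
proof -
  have xG: "x \<in> G"
    using x S openin_TG by blast
  \<comment> \<open>The clause \<open>z \<in> G\<close> keeps the quotients inside \<open>G\<close>,
    where the homomorphism law can be applied to them.\<close>
  define N where "N = {z \<in> G. mul x z \<in> S}"
  have N: "openin T N" "e \<in> N"
    using openin_translation_preimage[OF xG S] openin_TG identity_mem identity xG x
    by (auto simp: N_def)
  have "continuous_map (prod_topology TG TG) (prod_topology TG TG) (\<lambda>p. (inv (fst p), snd p))"
    by (intro continuous_map_pairedI continuous_map_snd
        continuous_map_compose[OF continuous_map_fst continuous_inv, unfolded o_def])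
  from continuous_map_compose[OF this continuous_mul]
  have "continuous_map (prod_topology TG TG) T (\<lambda>p. mul (inv (fst p)) (snd p))"
    by (simp add: o_def)
  from openin_continuous_map_preimage[OF this N(1)]
  have "openin (prod_topology TG TG) {p \<in> G \<times> G. mul (inv (fst p)) (snd p) \<in> N}"
    by (simp only: topspace_prod_topology topspace_TG)
  moreover have "(y, y) \<in> {p \<in> G \<times> G. mul (inv (fst p)) (snd p) \<in> N}"
    using y N inverse by simp
  ultimately obtain A B where AB: "openin TG A" "openin TG B" "y \<in> A" "y \<in> B"
      "A \<times> B \<subseteq> {p \<in> G \<times> G. mul (inv (fst p)) (snd p) \<in> N}"
    unfolding openin_prod_topology_alt by meson
  have "mul (inv v) w \<in> N" if "v \<in> A \<inter> B" "w \<in> A \<inter> B" for v w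
    using AB(5) that by auto
  then show ?thesis
    using AB by (intro exI[of _ "A \<inter> B"]) (auto simp: N_def)
qed

end

theorem theorem6p10:
  fixes U1 :: "'a set" and R1 :: "('a \<times> 'a) set" and mul1 :: "'a \<Rightarrow> 'a \<Rightarrow> 'a"
    and G1 :: "'a set" and T1 :: "'a topology"
    and U2 :: "'b set" and R2 :: "('b \<times> 'b) set" and mul2 :: "'b \<Rightarrow> 'b \<Rightarrow> 'b"
    and G2 :: "'b set" and T2 :: "'b topology"
    and f :: "'a \<Rightarrow> 'b"
  assumes "topological_rough_group U1 R1 mul1 G1 T1"
    and "topological_rough_group U2 R2 mul2 G2 T2"
    and "locally_compact_space (subtopology T1 G1)" and "Hausdorff_space (subtopology T1 G1)"
    and "locally_compact_space (subtopology T2 G2)" and "Hausdorff_space (subtopology T2 G2)"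
    and "rough_homomorphism U1 R1 mul1 G1 U2 R2 mul2 G2 f"
    and "continuous_map T1 T2 f"
    and "rough_identity U1 R1 mul1 G1 \<in> G1" and "rough_identity U2 R2 mul2 G2 \<in> G2"
    and "openin T1 G1" and "openin T2 G2"
    and "sigma_compact_space (subtopology T1 G1)"
  shows "open_map (subtopology T1 G1) (subtopology T2 G2) f"
proof -
  interpret A: open_topological_rough_group U1 R1 mul1 G1 T1
    using assms by unfold_locales
  interpret B: open_topological_rough_group U2 R2 mul2 G2 T2
    using assms by unfold_locales
  have mult: "f (mul1 x y) = mul2 (f x) (f y)" if "x \<in> G1" "y \<in> G1" for x y
    using assms(7) that unfolding rough_homomorphism_def by blast
  have fG: "f ` G1 = G2"
    using assms(7) unfolding rough_homomorphism_def by blast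
  \<comment> \<open>The image of the identity is idempotent and has an inverse in \<open>G2\<close>,
    so one factor cancels.\<close>
  have fe: "f A.e = B.e"
  proof -
    have m: "f A.e \<in> G2"
      using fG A.identity_mem by blast
    have "mul2 (f A.e) (f A.e) = f A.e"
      using mult[OF A.identity_mem A.identity_mem] A.identity A.identity_mem by simp
    then show ?thesis
      using B.assoc[OF B.inverse(1)[OF m] m m] B.inverse[OF m] B.identity m by simp
  qed
  have cont: "continuous_map A.TG B.TG f"
    using assms(8) fG by (auto simp: continuous_map_in_subtopology continuous_map_from_subtopology)
  show ?thesis
    unfolding open_map_def
  proof (intro allI impI)
    fix S assume S: "openin A.TG S"
    show "openin B.TG (f ` S)"
    proof (subst openin_subopen, rule ballI)
      fix b assume "b \<in> f ` S"
      then obtain x where x: "x \<in> S" "b = f x"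
        by blast
      have xG: "x \<in> G1" "f x \<in> G2"
        using x S A.openin_TG fG by blast+
      obtain P where P: "\<And>y. y \<in> G1 \<Longrightarrow> openin A.TG (P y) \<and> y \<in> P y \<and>
          (\<forall>v\<in>P y. \<forall>w\<in>P y. mul1 (A.inv v) w \<in> G1 \<and> mul1 x (mul1 (A.inv v) w) \<in> S)"
        using A.quotient_neighbourhood[OF x(1) S] by metis
      have "\<exists>y\<in>topspace A.TG. B.TG interior_of (f ` P y) \<noteq> {}"
        using assms Lindelof_space_sigma_compact cont P fG
        by (intro Lindelof_image_nonempty_interior)
          (auto simp: A.topspace_TG B.topspace_TG simp del: topspace_subtopology)
      then obtain y where y: "y \<in> G1" "B.TG interior_of (f ` P y) \<noteq> {}"
        by (auto simp: A.topspace_TG simp del: topspace_subtopology)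
      define M where "M = B.TG interior_of (f ` P y)"
      have M: "openin B.TG M" "M \<subseteq> f ` P y"
        by (simp_all add: M_def interior_of_subset)
      obtain c where c: "c \<in> P y" "f c \<in> M"
        using y M by (auto simp: M_def)
      have PG: "P y \<subseteq> G1"
        using P[OF y(1)] A.openin_TG by blast
      have cG: "c \<in> G1" "f c \<in> G2"
        using c PG fG by blast+
      let ?N = "{z \<in> G2. mul2 (f c) z \<in> M}"
      \<comment> \<open>This is the translate of \<open>M\<close> by \<open>f x\<close> and the
        inverse of \<open>f c\<close>, written as two successive preimages because the product of
        \<open>f c\<close> and \<open>B.inv (f x)\<close> may leave \<open>G2\<close>.\<close>
      let ?W = "{v \<in> G2. mul2 (B.inv (f x)) v \<in> ?N}"
      have "openin B.TG ?W"
        using B.openin_translation_preimage B.inverse(1) cG(2) xG(2) M(1) by presburger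
      moreover have "f x \<in> ?W"
        using xG B.inverse B.identity_mem B.identity cG c by simp
      moreover have "?W \<subseteq> f ` S"
      proof
        fix v assume "v \<in> ?W"
        define u where "u = mul2 (B.inv (f x)) v"
        have v: "v \<in> G2" and u: "u \<in> G2" "mul2 (f c) u \<in> M"
          using \<open>v \<in> ?W\<close> by (auto simp: u_def)
        obtain d where d: "d \<in> P y" "mul2 (f c) u = f d"
          using u M by blast
        \<comment> \<open>As \<open>f d\<close> is the product of \<open>f c\<close> and
          \<open>u\<close>, the quotient \<open>?t\<close> should map to \<open>u\<close>, and then
          \<open>mul1 x ?t\<close> is a preimage of \<open>v\<close> in \<open>S\<close>.\<close>
        let ?t = "mul1 (A.inv c) d"
        have t: "?t \<in> G1" "mul1 x ?t \<in> S"
          using P[OF y(1)] c d by blast+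
        have ic: "A.inv c \<in> G1" "f (A.inv c) \<in> G2"
          using A.inverse cG fG by blast+
        \<comment> \<open>Working with \<open>f (A.inv c)\<close> itself avoids proving that
          \<open>f\<close> commutes with inverses; \<open>fe\<close> suffices to cancel it against
          \<open>f c\<close>.\<close>
        have "f ?t = mul2 (f (A.inv c)) (mul2 (f c) u)"
          using mult ic d PG by auto
        also have "\<dots> = mul2 (f (mul1 (A.inv c) c)) u"
          using B.assoc ic cG u mult by simp
        also have "\<dots> = u"
          using A.inverse cG fe B.identity u by simp
        finally have "f (mul1 x ?t) = mul2 (f x) u"
          using mult xG t by simp
        also have "\<dots> = v"
          using B.assoc[of "f x" "B.inv (f x)" v] B.inverse[OF xG(2)] B.identity xG v
          by (simp add: u_def)
        finally show "v \<in> f ` S"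
          using t by blast
      qed
      ultimately show "\<exists>W. openin B.TG W \<and> b \<in> W \<and> W \<subseteq> f ` S"
        using x by blast
    qed
  qed
qed

end
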